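(* Let $X$ be a real Banach space. Let $A:X^*\to X$ be linear, monotone, injective and everywhere defined, and let $$T=A^{-1}:R(A)\subset X\to X^*,$$ where $R(A)$ is the range of $A$. If there exists $x^{**}_0\in X^{**}\setminus X$ such that $$\sup_{x^*\in X^*}\ \langle x^*,x^{**}_0\rangle-\langle A(x^* ),x^*\rangle<\infty,$$ then: 1. $T$ is maximal monotone of type (D) (as an operator $X\rightrightarrows X^*$); 2. $\widetilde{T}=\widehat{T}$; 3. $(\widetilde{T})^{-1}:X^*\rightrightarrows X^{**}$ is not of type (D) on $X^*\times X^{**}$.
   Context: A point-to-set operator $S:U\rightrightarrows V$ is a map from $U$ to the power set of $V$; its graph is $\mathrm{Gr}(S)=\{(u,v)\in U\times V : v\in S(u)\}$, its domain is $\{u\in U: S(u)\ne\emptyset\}$, its range is $R(S)=\{v\in V:\exists u\in U,\ v\in S(u)\}$, and its inverse $S^{-1}:V\rightrightarrows U$ is $S^{-1}(v)=\{u\in U: v\in S(u)\}$. The operator $S$ is point-to-point, written $S:U\to V$, if $S(u)$ is a singleton for each $u$ in its domain (the domain need not be all of $U$). For a real Banach space $Y$, $Y^*$ is the topological dual, $Y$ is identified with its canonical image in $Y^{**}$, and $\langle y,y^*\rangle=\langle y^*,y\rangle=y^*(y)$ for $y\in Y$, $y^*\in Y^*$. An operator $S:Y\rightrightarrows Y^*$ is monotone if $\langle x-y,x^*-y^*\rangle\ge 0$ for all $(x,x^* ),(y,y^* )\in\mathrm{Gr}(S)$; an operator $S:Y^{**}\rightrightarrows Y^*$ is monotone if $\langle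 x^*-y^*,x^{**}-y^{**}\rangle\ge0$ for all $(x^{**},x^* ),(y^{**},y^* )\in\mathrm{Gr}(S)$. It is maximal monotone if it is monotone and its graph is maximal, with respect to inclusion, among the graphs of monotone operators in $Y\times Y^*$ (respectively $Y^{**}\times Y^*$). An operator $A:X^*\to X$ is monotone if $\langle A(x^* )-A(y^* ),x^*-y^*\rangle\ge 0$ for all $x^*,y^*$ in its domain. For a maximal monotone $S:Y\rightrightarrows Y^*$: - $\widehat{S}:Y^{**}\rightrightarrows Y^*$ is the operator with $\mathrm{Gr}(\widehat S)=\mathrm{Gr}(S)$, viewed in $Y^{**}\times Y^*$. - Gossez's monotone closure $\widetilde S:Y^{**}\rightrightarrows Y^*$ is the operator with graph $\mathrm{Gr}(\widetilde S)=\{(y^{**},y^* )\in Y^{**}\times Y^* : \langle y^*-z^*,y^{**}-z\rangle\ge 0\ \ \forall (z,z^* )\in\mathrm{Gr}(S)\}$. - $S$ is of (Gossez) type (D) if for any $(y^{**},y^* )\in\mathrm{Gr}(\widetilde S)$ there exists a bounded net $((y_i,y_i^* ))_{i\in I}$ in $\mathrm{Gr}(S)$ which converges to $(y^{**},y^* )$ in the $\sigma(Y^{**},Y^* )\times$strong topology of $Y^{**}\times Y^*$. In item 1 these notions are used with $Y=X$; in item 3 with $Y=X^*$ (so that $Y^*=X^{**}$). *)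

theory Defs
  imports "HOL-Analysis.Analysis"
begin

type_synonym 'a dual = "('a, real) blinfun"
type_synonym 'a bidual = "'a dual dual"

definition canon :: "'a::real_normed_vector \<Rightarrow> 'a bidual" where
  "canon y = Blinfun (\<lambda>f. blinfun_apply f y)"

lemma canon_apply [simp]: "blinfun_apply (canon y) f = blinfun_apply f y"
  unfolding canon_def by (simp add: bounded_linear_Blinfun_apply blinfun.bounded_linear_left)

definition gr :: "('u \<Rightarrow> 'v set) \<Rightarrow> ('u \<times> 'v) set" where
  "gr S = {(u, v). v \<in> S u}"

definition op_inverse :: "('u \<Rightarrow> 'v set) \<Rightarrow> 'v \<Rightarrow> 'u set" where
  "op_inverse S v = {u. v \<in> S u}"

definition monotone_op :: "('a::real_normed_vector \<Rightarrow> 'a dual set) \<Rightarrow> bool" where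
  "monotone_op S \<longleftrightarrow>
     (\<forall>(x, x')\<in>gr S. \<forall>(y, y')\<in>gr S. blinfun_apply (x' - y') (x - y) \<ge> 0)"

definition maximal_monotone :: "('a::real_normed_vector \<Rightarrow> 'a dual set) \<Rightarrow> bool" where
  "maximal_monotone S \<longleftrightarrow>
     monotone_op S \<and> (\<forall>S'. monotone_op S' \<and> gr S \<subseteq> gr S' \<longrightarrow> gr S' = gr S)"

definition monotone_from_dual :: "('a::real_normed_vector dual \<Rightarrow> 'a) \<Rightarrow> bool" where
  "monotone_from_dual A \<longleftrightarrow> (\<forall>f g. blinfun_apply (f - g) (A f - A g) \<ge> 0)"

definition op_hat :: "('a::real_normed_vector \<Rightarrow> 'a dual set) \<Rightarrow> 'a bidual \<Rightarrow> 'a dual set" where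
  "op_hat S y'' = {y'. \<exists>y. y'' = canon y \<and> y' \<in> S y}"

definition gossez_closure ::
  "('a::real_normed_vector \<Rightarrow> 'a dual set) \<Rightarrow> 'a bidual \<Rightarrow> 'a dual set" where
  "gossez_closure S y'' =
     {y'. \<forall>(z, z')\<in>gr S. blinfun_apply (y'' - canon z) (y' - z') \<ge> 0}"

definition directed_set :: "'i set \<Rightarrow> ('i \<Rightarrow> 'i \<Rightarrow> bool) \<Rightarrow> bool" where
  "directed_set I le \<longleftrightarrow> I \<noteq> {} \<and>
     (\<forall>i\<in>I. le i i) \<and>
     (\<forall>i\<in>I. \<forall>j\<in>I. \<forall>k\<in>I. le i j \<and> le j k \<longrightarrow> le i k) \<and>
     (\<forall>i\<in>I. \<forall>j\<in>I. \<exists>k\<in>I. le i k \<and> le j k)"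

definition tail_filter :: "'i set \<Rightarrow> ('i \<Rightarrow> 'i \<Rightarrow> bool) \<Rightarrow> 'i filter" where
  "tail_filter I le = (INF i\<in>I. principal {j\<in>I. le i j})"

lemma eventually_tail_filter:
  assumes "directed_set I le"
  shows "eventually P (tail_filter I le) \<longleftrightarrow> (\<exists>i\<in>I. \<forall>j\<in>I. le i j \<longrightarrow> P j)"
proof -
  have "I \<noteq> {}" using assms by (simp add: directed_set_def)
  moreover have "\<exists>k\<in>I. principal {m\<in>I. le k m}
      \<le> inf (principal {m\<in>I. le i m}) (principal {m\<in>I. le j m})"
    if "i \<in> I" "j \<in> I" for i j
  proof -
    obtain k where k: "k \<in> I" "le i k" "le j k"
      using assms \<open>i \<in> I\<close> \<open>j \<in> I\<close> unfolding directed_set_def by blast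
    have "le i m \<and> le j m" if "m \<in> I" "le k m" for m
      using assms k that \<open>i \<in> I\<close> \<open>j \<in> I\<close> unfolding directed_set_def by blast
    then show ?thesis using k(1) by (intro bexI[of _ k]) auto
  qed
  ultimately show ?thesis
    unfolding tail_filter_def by (subst eventually_INF_base) (auto simp: eventually_principal)
qed

text \<open>The strong operator topology on the bidual, whose elements are functionals on the dual, is
  the topology of pointwise convergence on the dual, i.e. the weak-* topology
  \<open>\<sigma>(Y**, Y*)\<close>.\<close>

definition weak_star_strong_topology :: "('a::real_normed_vector bidual \<times> 'a dual) topology" where
  "weak_star_strong_topology = prod_topology strong_operator_topology euclidean"

definition bounded_net_to ::
  "'i set \<Rightarrow> ('i \<Rightarrow> 'i \<Rightarrow> bool) \<Rightarrow> ('i \<Rightarrow> 'a::real_normed_vector \<times> 'a dual) \<Rightarrow>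
   ('a \<Rightarrow> 'a dual set) \<Rightarrow> 'a bidual \<times> 'a dual \<Rightarrow> bool" where
  "bounded_net_to I le s S p \<longleftrightarrow>
     directed_set I le \<and> s ` I \<subseteq> gr S \<and> bounded (s ` I) \<and>
     limitin weak_star_strong_topology (\<lambda>i. (canon (fst (s i)), snd (s i))) p (tail_filter I le)"

text \<open>HOL cannot quantify over the type of the index set, so it is fixed here to sets of points of
  \<open>Y** \<times> Y*\<close>. This is no restriction: see \<open>type_D_if_nets\<close> below.\<close>

definition type_D :: "('a::real_normed_vector \<Rightarrow> 'a dual set) \<Rightarrow> bool" where
  "type_D S \<longleftrightarrow>
     (\<forall>p\<in>gr (gossez_closure S).
        \<exists>(I :: ('a bidual \<times> 'a dual) set set) le s. bounded_net_to I le s S p)"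

lemma bounded_net_to_reindex:
  fixes p :: "'a::real_normed_vector bidual \<times> 'a dual"
  assumes "bounded_net_to (I :: 'i set) le s S p"
  shows "\<exists>(J :: ('a bidual \<times> 'a dual) set set) le' s'. bounded_net_to J le' s' S p"
proof -
  let ?W = "weak_star_strong_topology :: ('a bidual \<times> 'a dual) topology"
  let ?e = "\<lambda>q :: 'a \<times> 'a dual. (canon (fst q), snd q)"
  define J where "J = {U. openin ?W U \<and> p \<in> U}"
  define le' where "le' = (\<lambda>U V :: ('a bidual \<times> 'a dual) set. V \<subseteq> U)"
  have dir: "directed_set I le" and sub: "s ` I \<subseteq> gr S" and bdd: "bounded (s ` I)"
    and lim: "limitin ?W (\<lambda>i. ?e (s i)) p (tail_filter I le)"
    using assms by (auto simp: bounded_net_to_def)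
  have p: "p \<in> topspace ?W" using lim by (simp add: limitin_def)
  have "\<exists>i\<in>I. ?e (s i) \<in> U" if "U \<in> J" for U
  proof -
    have "eventually (\<lambda>i. ?e (s i) \<in> U) (tail_filter I le)"
      using lim that by (simp add: limitin_def J_def)
    then show ?thesis
      using dir unfolding eventually_tail_filter[OF dir] directed_set_def by blast
  qed
  then obtain t where t: "\<And>U. U \<in> J \<Longrightarrow> t U \<in> I \<and> ?e (s (t U)) \<in> U" by metis
  have dirJ: "directed_set J le'"
    unfolding directed_set_def
  proof (intro conjI ballI)
    show "J \<noteq> {}" using p by (auto simp: J_def)
  next
    fix U V assume "U \<in> J" "V \<in> J"
    then show "\<exists>W\<in>J. le' U W \<and> le' V W"
      by (intro bexI[of _ "U \<inter> V"]) (auto simp: J_def le'_def)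
  qed (auto simp: le'_def)
  have "limitin ?W (\<lambda>U. ?e (s (t U))) p (tail_filter J le')"
    unfolding limitin_def eventually_tail_filter[OF dirJ]
  proof (intro conjI allI impI)
    fix U assume "openin ?W U \<and> p \<in> U"
    then have "U \<in> J" by (simp add: J_def)
    then show "\<exists>V\<in>J. \<forall>W\<in>J. le' V W \<longrightarrow> ?e (s (t W)) \<in> U"
      using t unfolding le'_def by blast
  qed (rule p)
  moreover have "(s \<circ> t) ` J \<subseteq> s ` I" using t by auto
  ultimately have "bounded_net_to J le' (s \<circ> t) S p"
    using dirJ sub bdd by (auto simp: bounded_net_to_def intro: bounded_subset)
  then show ?thesis by blast
qed

lemma type_D_if_nets:
  assumes "\<And>p. p \<in> gr (gossez_closure S) \<Longrightarrow>
             \<exists>(I :: 'i set) le s. bounded_net_to I le s S p"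
  shows "type_D S"
  unfolding type_D_def using assms bounded_net_to_reindex by blast

end

theory Submission
  imports Defs
begin

text \<open>
  Testing the monotone relation \<open>\<langle>x'' - A f, g - f\<rangle> \<ge> 0\<close> along \<open>f = g - t h\<close> forces \<open>x'' = A g\<close>. So the
  Gossez closure of \<open>T\<close> consists of the graph of \<open>T\<close> only, constant nets witness type (D), and both
  \<open>T\<close> and \<open>A : X* \<rightarrow> X**\<close> are maximal monotone. The second coordinates of the graph of
  \<open>A : X* \<rightarrow> X**\<close> lie in \<open>X\<close>, which is norm closed in \<open>X**\<close>, so if \<open>A\<close> were of type (D), the same
  would hold for its Gossez closure. But by Hahn--Banach there is \<open>n \<in> X***\<close> that vanishes on \<open>X\<close>
  with \<open>\<langle>n, x0\<rangle> > 0\<close>, and \<open>(c n, x0)\<close> is in that closure when \<open>c \<langle>n, x0\<rangle>\<close> bounds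
  \<open>\<langle>f, x0\<rangle> - \<langle>A f, f\<rangle>\<close>.
\<close>

section \<open>The Hahn--Banach theorem\<close>

text \<open>An inequality suffices in the scaling law: applying it again with factor
  \<open>1 / t\<close> gives equality.\<close>

definition sublinear :: "('v::real_vector \<Rightarrow> real) \<Rightarrow> bool" where
  "sublinear p \<longleftrightarrow> (\<forall>x y. p (x + y) \<le> p x + p y) \<and> (\<forall>t x. 0 \<le> t \<longrightarrow> p (t *\<^sub>R x) \<le> t * p x)"

lemma sublinear_add: "sublinear p \<Longrightarrow> p (x + y) \<le> p x + p y"
  by (simp add: sublinear_def)

lemma sublinear_scale_le: "sublinear p \<Longrightarrow> 0 \<le> t \<Longrightarrow> p (t *\<^sub>R x) \<le> t * p x"
  by (simp add: sublinear_def)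

lemma sublinear_zero:
  assumes "sublinear p"
  shows "p 0 = 0"
  using sublinear_add[OF assms, of 0 0] sublinear_scale_le[OF assms, of 0 0] by simp

lemma sublinear_neg:
  assumes "sublinear p"
  shows "- p (- x) \<le> p x"
  using sublinear_add[OF assms, of x "- x"] sublinear_zero[OF assms] by simp

lemma sublinear_scale:
  assumes p: "sublinear p" and t: "0 \<le> t"
  shows "p (t *\<^sub>R x) = t * p x"
proof (cases "t = 0")
  case True
  then show ?thesis using sublinear_zero[OF p] by simp
next
  case False
  then have "t > 0" using t by simp
  have "p ((1 / t) *\<^sub>R t *\<^sub>R x) \<le> (1 / t) * p (t *\<^sub>R x)"
    using \<open>t > 0\<close> by (intro sublinear_scale_le[OF p]) simp
  then have "t * p x \<le> p (t *\<^sub>R x)" using \<open>t > 0\<close> by (simp add: field_simps)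
  then show ?thesis using sublinear_scale_le[OF p t, of x] by simp
qed

text \<open>For sublinear \<open>p\<close>, this is the largest sublinear functional below
  \<open>p\<close> whose value at \<open>- y\<close> is at most \<open>- p y\<close>. A linear
  functional below it must agree with \<open>p\<close> at \<open>y\<close>.\<close>

definition tilt :: "('v::real_vector \<Rightarrow> real) \<Rightarrow> 'v \<Rightarrow> 'v \<Rightarrow> real" where
  "tilt p y x = (INF t\<in>{0..}. p (x + t *\<^sub>R y) - t * p y)"

lemma tilt_le:
  assumes p: "sublinear p" and t: "0 \<le> t"
  shows "tilt p y x \<le> p (x + t *\<^sub>R y) - t * p y"
proof -
  \<comment> \<open>A lower bound independent of \<open>s\<close>, so that the real infimum is a
    genuine one.\<close>
  have "- p (- x) \<le> p (x + s *\<^sub>R y) - s * p y" if "0 \<le> s" for s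
    using sublinear_add[OF p, of "x + s *\<^sub>R y" "- x"] sublinear_scale[OF p that, of y] by simp
  then show ?thesis
    unfolding tilt_def using t by (intro cINF_lower bdd_belowI2[of _ "- p (- x)"]) auto
qed

lemma tilt_greatest:
  "(\<And>t. 0 \<le> t \<Longrightarrow> m \<le> p (x + t *\<^sub>R y) - t * p y) \<Longrightarrow> m \<le> tilt p y x"
  unfolding tilt_def by (intro cINF_greatest) auto

lemma tilt_le_self: "sublinear p \<Longrightarrow> tilt p y x \<le> p x"
  using tilt_le[of p 0 y x] by simp

lemma sublinear_tilt:
  assumes p: "sublinear p"
  shows "sublinear (tilt p y)"
  unfolding sublinear_def
proof (intro conjI allI impI)
  fix x z
  \<comment> \<open>The two infima are taken one after the other: first over \<open>t\<close> with
    \<open>s\<close> fixed, then over \<open>s\<close>. The parameter \<open>t + s\<close> serves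
    for the sum.\<close>
  have "tilt p y (x + z) - (p (z + s *\<^sub>R y) - s * p y) \<le> tilt p y x" if s: "0 \<le> s" for s
  proof (rule tilt_greatest)
    fix t :: real assume t: "0 \<le> t"
    have "tilt p y (x + z) \<le> p (x + z + (t + s) *\<^sub>R y) - (t + s) * p y"
      using s t by (intro tilt_le[OF p]) simp
    moreover have "p (x + z + (t + s) *\<^sub>R y) \<le> p (x + t *\<^sub>R y) + p (z + s *\<^sub>R y)"
      using sublinear_add[OF p, of "x + t *\<^sub>R y" "z + s *\<^sub>R y"] by (simp add: algebra_simps)
    ultimately show "tilt p y (x + z) - (p (z + s *\<^sub>R y) - s * p y) \<le> p (x + t *\<^sub>R y) - t * p y"
      by (simp add: algebra_simps)
  qed
  then have "tilt p y (x + z) - tilt p y x \<le> p (z + s *\<^sub>R y) - s * p y" if "0 \<le> s" for s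
    using that by (smt (verit))
  then have "tilt p y (x + z) - tilt p y x \<le> tilt p y z" by (rule tilt_greatest)
  then show "tilt p y (x + z) \<le> tilt p y x + tilt p y z" by simp
next
  fix c :: real and x assume "0 \<le> c"
  show "tilt p y (c *\<^sub>R x) \<le> c * tilt p y x"
  proof (cases "c = 0")
    case True
    then show ?thesis using tilt_le_self[OF p, of y 0] sublinear_zero[OF p] by simp
  next
    case False
    then have "c > 0" using \<open>0 \<le> c\<close> by simp
    have "tilt p y (c *\<^sub>R x) / c \<le> tilt p y x"
    proof (rule tilt_greatest)
      fix t :: real assume "0 \<le> t"
      then have "tilt p y (c *\<^sub>R x) \<le> p (c *\<^sub>R x + (c * t) *\<^sub>R y) - (c * t) * p y"
        using \<open>c > 0\<close> by (intro tilt_le[OF p]) simp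
      also have "\<dots> = c * (p (x + t *\<^sub>R y) - t * p y)"
        using sublinear_scale[OF p \<open>0 \<le> c\<close>, of "x + t *\<^sub>R y"] by (simp add: algebra_simps)
      finally show "tilt p y (c *\<^sub>R x) / c \<le> p (x + t *\<^sub>R y) - t * p y"
        using \<open>c > 0\<close> by (simp add: field_simps)
    qed
    then show ?thesis using \<open>c > 0\<close> by (simp add: field_simps)
  qed
qed

section \<open>Minimal sublinear functionals by Zorn's lemma\<close>

lemma sublinear_chain_INF:
  assumes "C \<noteq> {}" and sub: "\<And>q. q \<in> C \<Longrightarrow> sublinear q \<and> q \<le> p"
    and chain: "\<And>q r. q \<in> C \<Longrightarrow> r \<in> C \<Longrightarrow> q \<le> r \<or> r \<le> q"
  shows "sublinear (\<lambda>x. INF q\<in>C. q x)" and "\<And>q. q \<in> C \<Longrightarrow> (\<lambda>x. INF q\<in>C. q x) \<le> q"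
proof -
  have lower: "(INF q\<in>C. q x) \<le> r x" if "r \<in> C" for r x
  proof (rule cINF_lower[OF _ that])
    \<comment> \<open>Bounds the chain below at \<open>x\<close>, since \<open>q x\<close> is at
      least \<open>- q (- x)\<close> and \<open>q\<close> lies below \<open>p\<close>.\<close>
    have "- p (- x) \<le> q x" if "q \<in> C" for q
      using sub[OF that] sublinear_neg[of q x] le_funD[of q p "- x"] by linarith
    then show "bdd_below ((\<lambda>q. q x) ` C)" by (intro bdd_belowI2[of _ "- p (- x)"])
  qed
  then show "(\<lambda>x. INF q\<in>C. q x) \<le> q" if "q \<in> C" for q using that by (simp add: le_funI)
  let ?i = "\<lambda>x. INF q\<in>C. q x"
  show "sublinear ?i"
    unfolding sublinear_def
  proof (intro conjI allI impI)
    fix x y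
    \<comment> \<open>The smaller of \<open>q\<close> and \<open>r\<close> works for both summands;
      this is where the chain property enters.\<close>
    have le: "?i (x + y) \<le> q x + r y" if q: "q \<in> C" and r: "r \<in> C" for q r
    proof (cases "q \<le> r")
      case True
      then show ?thesis
        using lower[OF q, of "x + y"] sublinear_add[of q x y] sub[OF q] le_funD[of q r y] by linarith
    next
      case False
      then have "r \<le> q" using chain q r by blast
      then show ?thesis
        using lower[OF r, of "x + y"] sublinear_add[of r x y] sub[OF r] le_funD[of r q x] by linarith
    qed
    have "?i (x + y) - r y \<le> ?i x" if "r \<in> C" for r
      using le[OF _ that] \<open>C \<noteq> {}\<close> by (intro cINF_greatest) (auto simp: algebra_simps)
    then have "?i (x + y) - ?i x \<le> ?i y"
      using \<open>C \<noteq> {}\<close> by (intro cINF_greatest) (auto simp: algebra_simps)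
    then show "?i (x + y) \<le> ?i x + ?i y" by simp
  next
    fix t :: real and x assume t: "0 \<le> t"
    have le: "?i (t *\<^sub>R x) \<le> t * q x" if "q \<in> C" for q
      using lower[OF that, of "t *\<^sub>R x"] sublinear_scale_le[of q t x] sub[OF that] t by linarith
    show "?i (t *\<^sub>R x) \<le> t * ?i x"
    proof (cases "t = 0")
      case True
      then show ?thesis using le \<open>C \<noteq> {}\<close> by auto
    next
      case False
      then have "t > 0" using t by simp
      then have "?i (t *\<^sub>R x) / t \<le> ?i x"
        using \<open>C \<noteq> {}\<close> le by (intro cINF_greatest) (auto simp: field_simps)
      then show ?thesis using \<open>t > 0\<close> by (simp add: field_simps)
    qed
  qed
qed

text \<open>Hahn--Banach without extending functionals from subspaces: a pointwise minimal sublinear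
  functional is linear, since it equals all its tilts.\<close>

lemma minimal_sublinear_below:
  assumes p: "sublinear p"
  obtains q where "sublinear q" "q \<le> p" "\<And>r. sublinear r \<Longrightarrow> r \<le> q \<Longrightarrow> r = q"
proof -
  \<comment> \<open>The order is reversed, so Zorn's maximal element is a minimal functional and the
    infimum of a chain is its upper bound.\<close>
  let ?A = "{q. sublinear q \<and> q \<le> p}" and ?P = "\<lambda>q r :: 'a \<Rightarrow> real. r \<le> q"
  have "\<exists>m\<in>?A. \<forall>a\<in>?A. ?P m a \<longrightarrow> a = m"
  proof (rule predicate_Zorn)
    show "partial_order_on ?A (relation_of ?P ?A)"
      by (auto simp: partial_order_on_def preorder_on_def refl_on_def trans_def antisym_def
          relation_of_def)
  next
    fix C assume C: "C \<in> Chains (relation_of ?P ?A)"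
    then have sub: "sublinear q \<and> q \<le> p" if "q \<in> C" for q
      using that unfolding Chains_def relation_of_def by blast
    have chain: "q \<le> r \<or> r \<le> q" if "q \<in> C" "r \<in> C" for q r
      using C that unfolding Chains_def relation_of_def by blast
    show "\<exists>u\<in>?A. \<forall>a\<in>C. ?P a u"
    proof (cases "C = {}")
      case True
      then show ?thesis using p by auto
    next
      case False
      note inf = sublinear_chain_INF[OF False sub chain]
      obtain c where "c \<in> C" using False by blast
      then have "(\<lambda>x. INF q\<in>C. q x) \<le> p" using inf(2) sub by (blast intro: order_trans)
      then show ?thesis using inf by (intro bexI[of _ "\<lambda>x. INF q\<in>C. q x"]) auto
    qed
  qed
  then obtain q where q: "sublinear q" "q \<le> p"
    and min: "\<And>r. sublinear r \<Longrightarrow> r \<le> p \<Longrightarrow> r \<le> q \<Longrightarrow> r = q" by auto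
  show ?thesis using that[OF q] min q(2) by (meson order_trans)
qed

lemma linear_if_minimal_sublinear:
  assumes q: "sublinear q" and min: "\<And>r. sublinear r \<Longrightarrow> r \<le> q \<Longrightarrow> r = q"
  shows "linear q"
proof -
  have add: "q (x + y) = q x + q y" for x y
  proof -
    have "tilt q y = q"
      using min[OF sublinear_tilt[OF q]] tilt_le_self[OF q] by (simp add: le_funI)
    then have "q x \<le> q (x + 1 *\<^sub>R y) - 1 * q y"
      using tilt_le[OF q, of 1 y x] by simp
    then show ?thesis using sublinear_add[OF q, of x y] by simp
  qed
  have neg: "q (- x) = - q x" for x
    using add[of x "- x"] sublinear_zero[OF q] by simp
  have "q (t *\<^sub>R x) = t * q x" for t x
  proof (cases "0 \<le> t")
    case True
    then show ?thesis by (rule sublinear_scale[OF q])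
  next
    case False
    then show ?thesis using sublinear_scale[OF q, of "- t" x] neg[of "t *\<^sub>R x"] by simp
  qed
  then show ?thesis using add by (intro linearI) auto
qed

text \<open>Minimizing below \<open>tilt p x0\<close> instead of \<open>p\<close> secures the value
  at \<open>x0\<close>: the parameter 1 in the tilt gives
  \<open>f (- x0) \<le> - p x0\<close>.\<close>

theorem Hahn_Banach_sublinear:
  assumes p: "sublinear p"
  obtains f where "linear f" "\<And>x. f x \<le> p x" "f x0 = p x0"
proof -
  obtain f where f: "sublinear f" "f \<le> tilt p x0" "\<And>r. sublinear r \<Longrightarrow> r \<le> f \<Longrightarrow> r = f"
    using minimal_sublinear_below[OF sublinear_tilt[OF p]] by blast
  have lin: "linear f" using f by (blast intro: linear_if_minimal_sublinear)
  have le: "f x \<le> p x" for x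
    using le_funD[OF f(2), of x] tilt_le_self[OF p, of x0 x] by linarith
  have "f (- x0) \<le> - p x0"
    using le_funD[OF f(2), of "- x0"] tilt_le[OF p, of 1 x0 "- x0"] sublinear_zero[OF p] by simp
  then have "f x0 = p x0" using le[of x0] linear_neg[OF lin, of x0] by simp
  with lin le show ?thesis by (rule that)
qed

section \<open>Continuous functionals that vanish on a subspace\<close>

lemma sublinear_infdist:
  fixes M :: "'v::real_normed_vector set"
  assumes M: "subspace M"
  shows "sublinear (\<lambda>x. infdist x M)"
  unfolding sublinear_def
proof (intro conjI allI impI)
  have ne: "M \<noteq> {}" using subspace_0[OF M] by blast
  have greatest: "m \<le> infdist x M" if "\<And>a. a \<in> M \<Longrightarrow> m \<le> dist x a" for m and x :: 'v
    unfolding infdist_notempty[OF ne] using that ne by (intro cINF_greatest) auto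
  fix x y :: 'v
  have "infdist (x + y) M - dist y b \<le> infdist x M" if b: "b \<in> M" for b
  proof (rule greatest)
    fix a assume "a \<in> M"
    then have "infdist (x + y) M \<le> dist (x + y) (a + b)"
      using subspace_add[OF M] b by (intro infdist_le) auto
    also have "\<dots> \<le> dist x a + dist y b" by (rule dist_triangle_add)
    finally show "infdist (x + y) M - dist y b \<le> dist x a" by simp
  qed
  then have "infdist (x + y) M - infdist x M \<le> dist y b" if "b \<in> M" for b
    using that by (smt (verit))
  then have "infdist (x + y) M - infdist x M \<le> infdist y M" by (rule greatest)
  then show "infdist (x + y) M \<le> infdist x M + infdist y M" by simp
next
  have ne: "M \<noteq> {}" using subspace_0[OF M] by blast
  fix t :: real and x :: 'v assume t: "0 \<le> t"
  show "infdist (t *\<^sub>R x) M \<le> t * infdist x M"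
  proof (cases "t = 0")
    case True
    then show ?thesis using subspace_0[OF M] by simp
  next
    case False
    then have "t > 0" using t by simp
    have "infdist (t *\<^sub>R x) M / t \<le> dist x a" if "a \<in> M" for a
    proof -
      have "infdist (t *\<^sub>R x) M \<le> dist (t *\<^sub>R x) (t *\<^sub>R a)"
        using subspace_scale[OF M that] by (rule infdist_le)
      also have "\<dots> = t * dist x a"
        using t by (simp add: dist_norm flip: scaleR_diff_right)
      finally show ?thesis using \<open>t > 0\<close> by (simp add: field_simps)
    qed
    then have "infdist (t *\<^sub>R x) M / t \<le> infdist x M"
      unfolding infdist_notempty[OF ne, of x] using ne by (intro cINF_greatest) auto
    then show ?thesis using \<open>t > 0\<close> by (simp add: field_simps)
  qed
qed

text \<open>The distance to \<open>M\<close> is a sublinear majorant that vanishes on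
  \<open>M\<close> and is at most the norm. Comparing at \<open>x\<close> and \<open>- x\<close>
  carries both properties over to \<open>f\<close>. The case \<open>M = {0}\<close> gives norming
  functionals, the range of \<open>canon\<close> gives annihilators.\<close>

theorem Hahn_Banach_subspace:
  fixes M :: "'v::real_normed_vector set"
  assumes M: "subspace M"
  obtains f :: "'v dual" where "norm f \<le> 1" "\<And>x. x \<in> M \<Longrightarrow> blinfun_apply f x = 0"
    "blinfun_apply f x0 = infdist x0 M"
proof -
  obtain f where f: "linear f" "\<And>x. f x \<le> infdist x M" "f x0 = infdist x0 M"
    using Hahn_Banach_sublinear[OF sublinear_infdist[OF M]] by blast
  have dist_le: "infdist x M \<le> norm x" for x
    using infdist_le[OF subspace_0[OF M], of x] by simp
  have bound: "\<bar>f x\<bar> \<le> norm x" for x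
    using f(2)[of x] f(2)[of "- x"] dist_le[of x] dist_le[of "- x"] linear_neg[OF f(1), of x]
    by simp
  have bl: "bounded_linear f"
    using f(1) bound
    by (intro bounded_linear_intro[of _ 1]) (auto simp: linear_add linear_scale)
  have vanish: "f x = 0" if "x \<in> M" for x
    using f(2)[of x] f(2)[of "- x"] that subspace_neg[OF M that] linear_neg[OF f(1), of x] by simp
  show ?thesis
  proof (rule that[of "Blinfun f"])
    show "norm (Blinfun f) \<le> 1"
      using bound by (intro norm_blinfun_bound) (auto simp: bounded_linear_Blinfun_apply[OF bl])
  qed (use vanish f(3) in \<open>simp_all add: bounded_linear_Blinfun_apply[OF bl]\<close>)
qed

section \<open>The canonical embedding\<close>

lemma bounded_linear_canon: "bounded_linear (canon :: 'a::real_normed_vector \<Rightarrow> 'a bidual)"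
proof (rule bounded_linear_intro[of _ 1])
  fix x :: 'a
  have "norm (canon x) \<le> norm x"
  proof (rule norm_blinfun_bound)
    show "norm (blinfun_apply (canon x) f) \<le> norm x * norm f" for f
      using norm_blinfun[of f x] by (simp add: mult.commute)
  qed simp
  then show "norm (canon x) \<le> norm x * 1" by simp
qed (auto intro!: blinfun_eqI simp: blinfun.bilinear_simps)

text \<open>The distance to \<open>{0}\<close> is the norm, so Hahn--Banach supplies a functional of
  norm at most 1 with value \<open>norm x\<close> at \<open>x\<close>.\<close>

lemma norm_canon_ge: "norm x \<le> norm (canon x)"
proof -
  obtain f :: "'a dual" where f: "norm f \<le> 1" "blinfun_apply f x = infdist x {0}"
    using Hahn_Banach_subspace[OF subspace_single_0] by blast
  have "norm x = blinfun_apply (canon x) f" using f(2) by simp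
  also have "\<dots> \<le> norm (canon x) * norm f" using norm_blinfun[of "canon x" f] by simp
  also have "\<dots> \<le> norm (canon x)" using f(1) by (simp add: mult_left_le)
  finally show ?thesis .
qed

lemma inj_canon: "inj canon"
proof (rule injI)
  fix x y :: 'a assume "canon x = canon y"
  then show "x = y"
    using norm_canon_ge[of "x - y"] linear_diff[OF bounded_linear.linear[OF bounded_linear_canon]]
    by (metis diff_self eq_iff_diff_eq_0 norm_le_zero_iff norm_zero)
qed

text \<open>Completeness of the space enters here: a linear map that does not shrink norms has a
  complete, hence closed, image.\<close>

lemma closed_range_canon: "closed (range (canon :: 'a::banach \<Rightarrow> 'a bidual))"
  using complete_isometric_image[OF zero_less_one subspace_UNIV bounded_linear_canon]
    norm_canon_ge complete_UNIV by (auto intro: complete_imp_closed)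

text \<open>The value of \<open>n\<close> at \<open>x0\<close> is the distance from
  \<open>x0\<close> to the range of \<open>canon\<close>, positive because the range is
  closed.\<close>

lemma annihilator_canon_separates:
  fixes x0 :: "'a::banach bidual"
  assumes "x0 \<notin> range canon"
  obtains n :: "'a bidual dual"
  where "\<And>x. blinfun_apply n (canon x) = 0" "blinfun_apply n x0 > 0"
proof -
  have sub: "subspace (range (canon :: 'a \<Rightarrow> _))"
    by (intro linear_subspace_image bounded_linear.linear bounded_linear_canon subspace_UNIV)
  have "infdist x0 (range canon) \<noteq> 0"
    using assms in_closed_iff_infdist_zero[OF closed_range_canon] by blast
  then have "infdist x0 (range canon) > 0" using infdist_nonneg[of x0 "range canon"] by linarith
  then show ?thesis using Hahn_Banach_subspace[OF sub, of x0] that by (metis rangeI)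
qed

section \<open>The operator and its Gossez closure\<close>

text \<open>Testing with \<open>f = g - t h\<close> and letting \<open>t\<close> tend to \<open>0\<close> removes the quadratic term.\<close>

lemma monotonically_related_imp_eq:
  fixes A :: "'a::real_normed_vector dual \<Rightarrow> 'a"
  assumes A: "linear A"
    and rel: "\<And>f. 0 \<le> blinfun_apply (x'' - canon (A f)) (g - f)"
  shows "x'' = canon (A g)"
proof (rule blinfun_eqI)
  have ge: "0 \<le> blinfun_apply (x'' - canon (A g)) h" for h
  proof (rule tendsto_lowerbound)
    show "((\<lambda>t. blinfun_apply (x'' - canon (A g)) h + t * blinfun_apply h (A h))
        \<longlongrightarrow> blinfun_apply (x'' - canon (A g)) h) (at_right 0)"
      by (auto intro!: tendsto_eq_intros)
    have "0 \<le> blinfun_apply (x'' - canon (A g)) h + t * blinfun_apply h (A h)" if "t > 0" for t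
    proof -
      have "0 \<le> t * (blinfun_apply (x'' - canon (A g)) h + t * blinfun_apply h (A h))"
        using rel[of "g - t *\<^sub>R h"]
        by (simp add: linear_diff[OF A] linear_scale[OF A] blinfun.bilinear_simps algebra_simps)
      then show ?thesis using that by (simp add: zero_le_mult_iff)
    qed
    then show "\<forall>\<^sub>F t in at_right 0.
        0 \<le> blinfun_apply (x'' - canon (A g)) h + t * blinfun_apply h (A h)"
      by (auto simp: eventually_at_filter)
  qed simp
  fix h
  show "blinfun_apply x'' h = blinfun_apply (canon (A g)) h"
    using ge[of h] ge[of "- h"] by (simp add: blinfun.bilinear_simps)
qed

text \<open>Each point of a monotone extension is monotonically related to the whole graph of
  \<open>S\<close>.\<close>

lemma maximal_monotoneI:
  assumes mono: "monotone_op S"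
    and max: "\<And>x x'. (\<And>y y'. (y, y') \<in> gr S \<Longrightarrow> 0 \<le> blinfun_apply (x' - y') (x - y))
               \<Longrightarrow> (x, x') \<in> gr S"
  shows "maximal_monotone S"
  unfolding maximal_monotone_def
proof (intro conjI allI impI mono)
  fix S' assume S': "monotone_op S' \<and> gr S \<subseteq> gr S'"
  have "(x, x') \<in> gr S" if "(x, x') \<in> gr S'" for x x'
    using S' that unfolding monotone_op_def by (intro max) blast
  then show "gr S' = gr S" using S' by auto
qed

lemma gr_op_inverse_fun: "gr (op_inverse (\<lambda>f. {A f})) = range (\<lambda>f. (A f, f))"
  by (auto simp: gr_def op_inverse_def)

context
  fixes A :: "'a::real_normed_vector dual \<Rightarrow> 'a"
  assumes lin: "linear A" and mono: "monotone_from_dual A"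
begin

lemma monotone_canon: "0 \<le> blinfun_apply (canon (A g) - canon (A f)) (g - f)"
  using mono[unfolded monotone_from_dual_def, rule_format, of g f]
  by (simp add: blinfun.bilinear_simps)

text \<open>The test in the bidual yields \<open>canon x = canon (A g)\<close>, and injectivity of
  \<open>canon\<close> brings this back to the space itself.\<close>

lemma maximal_monotone_inverse: "maximal_monotone (op_inverse (\<lambda>f. {A f}))"
proof (rule maximal_monotoneI)
  show "monotone_op (op_inverse (\<lambda>f. {A f}))"
    using mono unfolding monotone_op_def gr_op_inverse_fun monotone_from_dual_def by auto
next
  fix x g
  assume rel: "\<And>y f. (y, f) \<in> gr (op_inverse (\<lambda>f. {A f})) \<Longrightarrow> 0 \<le> blinfun_apply (g - f) (x - y)"
  have "0 \<le> blinfun_apply (canon x - canon (A f)) (g - f)" for f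
    using rel[of "A f" f] unfolding gr_op_inverse_fun by (simp add: blinfun.bilinear_simps)
  then have "canon x = canon (A g)" by (rule monotonically_related_imp_eq[OF lin])
  then show "(x, g) \<in> gr (op_inverse (\<lambda>f. {A f}))"
    using inj_canon by (auto simp: gr_op_inverse_fun dest: injD)
qed

text \<open>One inclusion is the variational test, the other is monotonicity of
  \<open>A\<close>.\<close>

lemma gossez_closure_inverse:
  "gossez_closure (op_inverse (\<lambda>f. {A f})) = op_inverse (\<lambda>f. {canon (A f)})"
proof (intro ext set_eqI)
  fix x'' :: "'a bidual" and g :: "'a dual"
  have "g \<in> gossez_closure (op_inverse (\<lambda>f. {A f})) x''
      \<longleftrightarrow> (\<forall>f. 0 \<le> blinfun_apply (x'' - canon (A f)) (g - f))"
    unfolding gossez_closure_def gr_op_inverse_fun by auto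
  also have "\<dots> \<longleftrightarrow> x'' = canon (A g)"
    using monotonically_related_imp_eq[OF lin, of x'' g] monotone_canon by blast
  finally show "g \<in> gossez_closure (op_inverse (\<lambda>f. {A f})) x''
      \<longleftrightarrow> g \<in> op_inverse (\<lambda>f. {canon (A f)}) x''"
    by (simp add: op_inverse_def)
qed

text \<open>The same test applies to \<open>A\<close> viewed as an operator from the dual into the
  bidual, which is the inverse of the Gossez closure.\<close>

lemma maximal_monotone_canon: "maximal_monotone (\<lambda>f. {canon (A f)})"
proof (rule maximal_monotoneI)
  show "monotone_op (\<lambda>f. {canon (A f)})"
    using monotone_canon by (auto simp: monotone_op_def gr_def)
next
  fix g x''
  assume "\<And>f y. (f, y) \<in> gr (\<lambda>f. {canon (A f)}) \<Longrightarrow> 0 \<le> blinfun_apply (x'' - y) (g - f)"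
  then have "x'' = canon (A g)" by (intro monotonically_related_imp_eq[OF lin]) (auto simp: gr_def)
  then show "(g, x'') \<in> gr (\<lambda>f. {canon (A f)})" by (simp add: gr_def)
qed

end

lemma op_inverse_op_inverse: "op_inverse (op_inverse S) = S"
  by (auto simp: op_inverse_def fun_eq_iff)

lemma op_hat_op_inverse: "op_hat (op_inverse (\<lambda>f. {A f})) = op_inverse (\<lambda>f. {canon (A f)})"
  by (auto simp: op_hat_def op_inverse_def fun_eq_iff)

section \<open>Type (D)\<close>

lemma type_D_if_closure_eq_hat:
  assumes "gossez_closure S = op_hat S"
  shows "type_D S"
proof (rule type_D_if_nets)
  fix p assume "p \<in> gr (gossez_closure S)"
  then obtain y y' where p: "p = (canon y, y')" "(y, y') \<in> gr S"
    unfolding assms by (auto simp: gr_def op_hat_def)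
  \<comment> \<open>The constant net on a one-point index set.\<close>
  have "bounded_net_to {()} (\<lambda>_ _. True) (\<lambda>_. (y, y')) S p"
    using p by (auto simp: bounded_net_to_def directed_set_def weak_star_strong_topology_def
        strong_operator_topology_topspace)
  then show "\<exists>(I :: unit set) le s. bounded_net_to I le s S p" by blast
qed

text \<open>Second coordinates converge in norm, so a closed set containing them contains their
  limit.\<close>

lemma type_D_closure_range:
  assumes D: "type_D S" and p: "(y'', y') \<in> gr (gossez_closure S)"
    and C: "closed C" "snd ` gr S \<subseteq> C"
  shows "y' \<in> C"
proof -
  obtain I :: "('a bidual \<times> 'a dual) set set" and le s
    where net: "bounded_net_to I le s S (y'', y')"
    using D p unfolding type_D_def by blast
  then have dir: "directed_set I le" and sub: "s ` I \<subseteq> gr S"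
    and lim: "((\<lambda>i. snd (s i)) \<longlongrightarrow> y') (tail_filter I le)"
    by (auto simp: bounded_net_to_def weak_star_strong_topology_def limitin_pairwise o_def)
  show ?thesis
  proof (rule Lim_in_closed_set[OF C(1) _ _ lim])
    have "I \<noteq> {}" and refl: "\<And>i. i \<in> I \<Longrightarrow> le i i" using dir by (auto simp: directed_set_def)
    then show "\<forall>\<^sub>F i in tail_filter I le. snd (s i) \<in> C"
      using sub C(2) unfolding eventually_tail_filter[OF dir] by blast
    \<comment> \<open>Every tail contains its starting index by reflexivity.\<close>
    show "tail_filter I le \<noteq> bot"
      using refl unfolding trivial_limit_def eventually_tail_filter[OF dir] by blast
  qed
qed

lemma not_type_D_canon:
  fixes A :: "'a::banach dual \<Rightarrow> 'a"
  assumes x0: "x0 \<notin> range canon"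
    and M: "\<And>f. blinfun_apply x0 f - blinfun_apply f (A f) \<le> M"
  shows "\<not> type_D (\<lambda>f. {canon (A f)})"
proof
  assume D: "type_D (\<lambda>f. {canon (A f)})"
  obtain n :: "'a bidual dual"
    where n: "\<And>x. blinfun_apply n (canon x) = 0" "blinfun_apply n x0 > 0"
    using annihilator_canon_separates[OF x0] by blast
  \<comment> \<open>With this scaling the pairing below equals \<open>M - (x0 f - f (A f))\<close>,
    because \<open>n\<close> vanishes at \<open>canon (A f)\<close>.\<close>
  let ?c = "M / blinfun_apply n x0"
  have "0 \<le> blinfun_apply (?c *\<^sub>R n - canon f) (x0 - canon (A f))" for f
    using n M[of f] by (simp add: blinfun.bilinear_simps)
  then have "(?c *\<^sub>R n, x0) \<in> gr (gossez_closure (\<lambda>f. {canon (A f)}))"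
    by (auto simp: gr_def gossez_closure_def)
  then have "x0 \<in> range canon"
    by (rule type_D_closure_range[OF D _ closed_range_canon]) (auto simp: gr_def)
  then show False using x0 by blast
qed

theorem theorem2p1:
  fixes A :: "'a::banach dual \<Rightarrow> 'a"
    and T :: "'a \<Rightarrow> 'a dual set"
  assumes "linear A"
    and "monotone_from_dual A"
    and "inj A"
    and "T = op_inverse (\<lambda>f. {A f})"
    and "\<exists>x0 :: 'a bidual. x0 \<notin> range canon \<and>
           (SUP f. ereal (blinfun_apply x0 f - blinfun_apply f (A f))) < \<infinity>"
  shows "(maximal_monotone T \<and> type_D T) \<and>
         gossez_closure T = op_hat T \<and>
         (maximal_monotone (op_inverse (gossez_closure T)) \<and>
          \<not> type_D (op_inverse (gossez_closure T)))"
proof -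
  obtain x0 :: "'a bidual" where x0: "x0 \<notin> range canon"
    and "(SUP f. ereal (blinfun_apply x0 f - blinfun_apply f (A f))) < \<infinity>"
    using assms(5) by blast
  \<comment> \<open>The finite extended supremum is turned into a real bound.\<close>
  then obtain M where "(SUP f. ereal (blinfun_apply x0 f - blinfun_apply f (A f))) < ereal M"
    using less_PInf_Ex_of_nat by (metis ereal_dense2)
  then have "ereal (blinfun_apply x0 f - blinfun_apply f (A f)) < ereal M" for f
    by (rule le_less_trans[OF SUP_upper[OF UNIV_I]])
  then have M: "blinfun_apply x0 f - blinfun_apply f (A f) \<le> M" for f
    by (simp add: less_imp_le)
  have closure: "gossez_closure T = op_inverse (\<lambda>f. {canon (A f)})"
    unfolding assms(4) by (rule gossez_closure_inverse[OF assms(1,2)])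
  have hat: "gossez_closure T = op_hat T"
    unfolding closure unfolding assms(4) by (rule op_hat_op_inverse[symmetric])
  have "maximal_monotone T"
    unfolding assms(4) by (rule maximal_monotone_inverse[OF assms(1,2)])
  moreover have "op_inverse (gossez_closure T) = (\<lambda>f. {canon (A f)})"
    unfolding closure by (rule op_inverse_op_inverse)
  ultimately show ?thesis
    using type_D_if_closure_eq_hat[OF hat] hat maximal_monotone_canon[OF assms(1,2)]
      not_type_D_canon[OF x0 M] by simp
qed

end
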